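(* Let $G \subset \mathbb{F}_q^k$ be an arc and let $n \in \mathbb{N}$ be a natural number such that \[ n+k-1 \le |G| \le \frac{q+2k-2+n}{2}. \] If the matrix $M_G^{\uparrow n}$ (constructed with respect to a basis $B$ of $\mathbb{F}_q^k$) has full row rank over $\mathbb{F}_q$, then the arc $G$ cannot be extended to an arc of size $q+2k-1+n-|G|$, i.e. there is no arc $S\subset\mathbb{F}_q^k$ of size $q+2k-1+n-|G|$ containing $G$ as a subfamily.
   Context: $\mathbb{F}_q$ is a finite field of order $q$ and characteristic $p$. An arc in $\mathbb{F}_q^k$ is an ordered family of at least $k$ vectors in which every subfamily of size $k$ is a basis of $\mathbb{F}_q^k$; subfamilies inherit the order. For a finite set $X$, $\binom{X}{m}$ denotes the set of $m$-element subsets of $X$. For a basis $B$ of $\mathbb{F}_q^k$, a vector $u$ and $C\in\binom{G}{k-1}$, $\det(u,C)_B$ denotes the determinant of the $k\times k$ matrix whose first row is $u$ written in coordinates with respect to $B$ and whose last $k-1$ rows are the elements of $C$ written with respect to $B$ in the order inherited from $G$. For an arc $G$ and $0\le n\le |G|-k+1$, $M_G^{\uparrow n}$ is the matrix over $\mathbb{F}_q$ whose rows are indexed by $\binom{G}{k-1}$, whose columns are indexed by ordered pairs $(U,A)$ with $U\in\binom{G}{n}$ and $A\in\binom{G\setminus U}{k-2}$, and whose $(C,(U,A))$-entry is $\prod_{u\in U}\det(u,C)_B$ if $A\subset C\subset G\setminus U$ and $0$ otherwise. *)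

theory Defs
  imports "Jordan_Normal_Form.DL_Rank" "HOL-Library.Sublist" "HOL-Library.Cardinality"
begin

text \<open>
  Ordered families of vectors are lists.  Subfamilies are order-preserving: \<^const>\<open>subseq\<close>, or
  \<^const>\<open>nths\<close> when positions matter.  Subsets of a family are sets of positions, so
  that nothing depends on its entries being pairwise distinct.
\<close>

definition basis_family :: "nat \<Rightarrow> 'a::field vec list \<Rightarrow> bool" where
  "basis_family k B \<longleftrightarrow>
     distinct B \<and> vectorspace.basis class_ring (module_vec TYPE('a) k) (set B)"

definition is_arc :: "nat \<Rightarrow> 'a::field vec list \<Rightarrow> bool" where
  "is_arc k G \<longleftrightarrow>
     set G \<subseteq> carrier_vec k \<and> k \<le> length G \<and>
     (\<forall>T. subseq T G \<and> length T = k \<longrightarrow> basis_family k T)"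

definition coords :: "nat \<Rightarrow> 'a::field vec list \<Rightarrow> 'a vec \<Rightarrow> 'a vec" where
  "coords k B u = (THE c. c \<in> carrier_vec k \<and> mat_of_cols k B *\<^sub>v c = u)"

definition det_wrt :: "nat \<Rightarrow> 'a::field vec list \<Rightarrow> 'a vec \<Rightarrow> 'a vec list \<Rightarrow> 'a" where
  "det_wrt k B u C = det (mat_of_rows k (map (coords k B) (u # C)))"

definition position_sets :: "nat \<Rightarrow> nat set list" where
  "position_sets N = map set (subseqs [0..<N])"

text \<open>
  Sizes \<open>k - 1\<close> and \<open>k - 2\<close> are written without truncated subtraction: for \<open>k = 1\<close> there are no
  sets of size \<open>k - 2\<close>, and hence no columns.
\<close>

definition row_labels :: "nat \<Rightarrow> nat \<Rightarrow> nat set list" where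
  "row_labels k N = filter (\<lambda>C. card C + 1 = k) (position_sets N)"

definition col_labels :: "nat \<Rightarrow> nat \<Rightarrow> nat \<Rightarrow> (nat set \<times> nat set) list" where
  "col_labels k n N =
     filter (\<lambda>(U, A). card U = n \<and> card A + 2 = k \<and> A \<inter> U = {})
       (List.product (position_sets N) (position_sets N))"

lemma distinct_position_sets: "distinct (position_sets N)"
  unfolding position_sets_def by (rule distinct_set_subseqs) simp

lemma set_position_sets: "set (position_sets N) = Pow {..<N}"
  by (simp add: position_sets_def subseqs_powset lessThan_atLeast0 del: in_set_subseqs)

lemma row_labels_enum:
  "distinct (row_labels k N)"
  "set (row_labels k N) = {C. C \<subseteq> {..<N} \<and> card C + 1 = k}"
  by (auto simp: row_labels_def distinct_position_sets set_position_sets)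

lemma col_labels_enum:
  "distinct (col_labels k n N)"
  "set (col_labels k n N) =
     {(U, A). U \<subseteq> {..<N} \<and> card U = n \<and> A \<subseteq> {..<N} - U \<and> card A + 2 = k}"
  by (auto simp: col_labels_def distinct_position_sets set_position_sets distinct_product)

definition arc_entry ::
  "nat \<Rightarrow> 'a::field vec list \<Rightarrow> 'a vec list \<Rightarrow> nat set \<Rightarrow> nat set \<times> nat set \<Rightarrow> 'a" where
  "arc_entry k B G C = (\<lambda>(U, A).
     if A \<subseteq> C \<and> C \<subseteq> {..<length G} - U
     then \<Prod>u\<in>U. det_wrt k B (G ! u) (nths G C)
     else 0)"

definition arc_matrix :: "nat \<Rightarrow> 'a::field vec list \<Rightarrow> 'a vec list \<Rightarrow> nat \<Rightarrow> 'a mat" where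
  "arc_matrix k B G n =
     mat (length (row_labels k (length G))) (length (col_labels k n (length G)))
       (\<lambda>(i, j). arc_entry k B G (row_labels k (length G) ! i) (col_labels k n (length G) ! j))"

definition full_row_rank :: "'a::field mat \<Rightarrow> bool" where
  "full_row_rank A \<longleftrightarrow> vec_space.rank (dim_row A) A = dim_row A"

end

theory Submission
  imports Defs "HOL-Computational_Algebra.Polynomial"
begin

text \<open>
  Suppose that \<open>S\<close> is an arc of the forbidden size that contains \<open>G\<close>.  Then the vector with entries
  \<open>v C = 1 / ((\<Prod>s \<in> S - C. det(s, C)) * (\<Prod>u \<in> G - C. det(u, C)))\<close>, all nonzero, lies in the
  left kernel of the matrix.  For the column \<open>(U, A)\<close> put \<open>V = S - A\<close>, \<open>E = G - (U \<union> A)\<close> and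
  \<open>[x, y] = det(x, y, A)\<close>.  The signs that come from moving \<open>e\<close> to the front of \<open>A \<union> {e}\<close> occur
  \<open>q + 1\<close> times and cancel, so the claim is that the sum over \<open>e \<in> E\<close> of
  \<open>1 / ((\<Prod>s \<in> V - {e}. [s, e]) * (\<Prod>u \<in> E - {e}. [u, e]))\<close> vanishes.  Modulo \<open>A\<close> the elements of
  \<open>V\<close> are points of a projective line.  Send one point of \<open>E\<close> to infinity; the other points of
  \<open>V\<close> and \<open>E\<close> become sets \<open>Y \<subseteq> X\<close> of field elements with \<open>card X + card Y = q + 1\<close>.  Wilson's
  theorem replaces the product over \<open>X - {y}\<close> by the product over the complement of \<open>X\<close>, which is
  a polynomial in \<open>y\<close> of degree \<open>card Y - 1\<close>, and Lagrange interpolation on \<open>Y\<close> evaluates the sum.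
\<close>

subsection \<open>Sums over a finite field\<close>

text \<open>Lagrange interpolation: \<open>p\<close> has degree below \<open>card Y\<close>, so it
  equals its interpolant on \<open>Y\<close>, and the sum is the coefficient of that interpolant in
  degree \<open>card Y - 1\<close>.\<close>

lemma sum_divided_differences:
  fixes Y :: "'a::field set" and p :: "'a poly"
  assumes fin: "finite Y" and deg: "degree p < card Y"
  shows "(\<Sum>y\<in>Y. poly p y / (\<Prod>u\<in>Y - {y}. y - u)) = coeff p (card Y - 1)"
proof -
  \<comment> \<open>\<open>L y\<close> is the Lagrange basis polynomial at \<open>y\<close> before
    normalisation: monic of degree \<open>card Y - 1\<close>, zero on \<open>Y\<close> except at
    \<open>y\<close>.\<close>
  define L where "L = (\<lambda>y. \<Prod>u\<in>Y - {y}. [:-u, 1:])"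
  define r where "r = (\<Sum>y\<in>Y. Polynomial.smult (poly p y / (\<Prod>u\<in>Y - {y}. y - u)) (L y))"
  have degL: "degree (L y) = card Y - 1" if "y \<in> Y" for y
    unfolding L_def using that fin by (subst degree_prod_eq_sum_degree) auto
  have lead: "coeff (L y) (card Y - 1) = 1" if "y \<in> Y" for y
  proof -
    have "lead_coeff (L y) = 1"
      unfolding L_def by (simp add: lead_coeff_prod)
    then show ?thesis
      using degL[OF that] by simp
  qed
  have polyL: "poly (L y) x = (if x = y then \<Prod>u\<in>Y - {y}. y - u else 0)"
    if "x \<in> Y" "y \<in> Y" for x y
    using that fin by (auto simp: L_def poly_prod prod_zero_iff)
  have nz: "(\<Prod>u\<in>Y - {y}. y - u) \<noteq> 0" for y
    using fin by (auto simp: prod_zero_iff)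
  have "p = r"
  proof (rule poly_eqI_degree[of Y])
    fix x assume x: "x \<in> Y"
    have "poly r x = (\<Sum>y\<in>Y. if x = y then poly p y else 0)"
      unfolding r_def poly_sum using x by (intro sum.cong refl) (auto simp: polyL nz)
    then show "poly p x = poly r x"
      using x fin by (simp add: sum.delta')
  next
    show "degree p < card Y" by (rule deg)
    have "degree r \<le> card Y - 1"
      unfolding r_def by (intro degree_sum_le fin) (metis degL degree_smult_le)
    then show "degree r < card Y" using deg by linarith
  qed
  then have "coeff p (card Y - 1) = coeff r (card Y - 1)" by simp
  also have "\<dots> = (\<Sum>y\<in>Y. poly p y / (\<Prod>u\<in>Y - {y}. y - u))"
    unfolding r_def coeff_sum by (intro sum.cong refl) (simp add: lead del: One_nat_def)
  finally show ?thesis ..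
qed

section \<open>Fermat and Wilson in a finite field\<close>

lemma finite_field_power_card_minus_1:
  fixes x :: "'a::{field,finite}"
  assumes "x \<noteq> 0"
  shows "x ^ (CARD('a) - 1) = 1"
proof -
  let ?N = "UNIV - {0 :: 'a}"
  have "bij_betw ((*) x) ?N ?N"
    by (rule bij_betw_byWitness[where f' = "\<lambda>y. y / x"]) (use assms in auto)
  then have "(\<Prod>y\<in>?N. x * y) = \<Prod>?N"
    using prod.reindex_bij_betw[of "(*) x" ?N ?N "\<lambda>y. y"] by simp
  then have "x ^ (CARD('a) - 1) * \<Prod>?N = \<Prod>?N"
    by (simp add: prod.distrib card_Diff_singleton)
  moreover have "\<Prod>?N \<noteq> 0" by (simp add: prod_zero_iff)
  ultimately show ?thesis by simp
qed

lemma finite_field_power_card: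
  fixes x :: "'a::{field,finite}"
  shows "x ^ CARD('a) = x"
proof (cases "x = 0")
  case False
  have "x ^ CARD('a) = x * x ^ (CARD('a) - 1)"
    by (metis finite_UNIV_card_ge_0 finite power_eq_if not_less_zero)
  then show ?thesis
    using finite_field_power_card_minus_1[OF False] by simp
qed simp

text \<open>Compare the constant terms of \<open>X^(q-1) - 1\<close> and of the product of all
  \<open>X - a\<close> with \<open>a\<close> nonzero. The sign \<open>(-1)^(q-1)\<close> is 1 by
  Fermat applied to \<open>-1\<close>, so the parity of \<open>q\<close> need not be
  distinguished.\<close>

lemma finite_field_wilson: "\<Prod>(UNIV - {0 :: 'a::{field,finite}}) = -1"
proof -
  let ?N = "UNIV - {0 :: 'a}"
  define p :: "'a poly" where "p = (\<Prod>a\<in>?N. [:-a, 1:])"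
  have card_gt: "1 < CARD('a)"
    using card_mono[of UNIV "{0, 1 :: 'a}"] by simp
  have cardN: "card ?N = CARD('a) - 1" by (simp add: card_Diff_singleton)
  have degp: "degree p = CARD('a) - 1"
    unfolding p_def using cardN by (subst degree_prod_eq_sum_degree) auto
  have leadp: "lead_coeff p = 1"
    unfolding p_def by (simp add: lead_coeff_prod)
  define m :: "'a poly" where "m = monom 1 (CARD('a) - 1) - 1"
  have degm: "degree m \<le> CARD('a) - 1"
    unfolding m_def by (intro degree_diff_le degree_monom_le) simp
  have "m = p"
  \<comment> \<open>Both sides have degree at most \<open>q - 1\<close> and the same coefficient
    there, so agreement at the \<open>q - 1\<close> nonzero points is enough.\<close>
  proof (rule poly_eqI_degree_lead_coeff[of _ "CARD('a) - 1" _ ?N])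
    show "coeff m (CARD('a) - 1) = coeff p (CARD('a) - 1)"
      using leadp degp card_gt by (simp add: m_def)
  next
    fix z :: 'a assume z: "z \<in> ?N"
    have "poly p z = 0" unfolding p_def poly_prod using z by (auto simp: prod_zero_iff)
    moreover have "poly m z = 0"
      using z finite_field_power_card_minus_1[of z] by (simp add: m_def poly_monom)
    ultimately show "poly m z = poly p z" by simp
  qed (use degp degm cardN in auto)
  then have "poly m 0 = poly p 0" by simp
  then have "-1 = (\<Prod>a\<in>?N. - a)"
    using card_gt by (simp add: m_def p_def poly_prod poly_monom zero_power)
  also have "\<dots> = (-1) ^ (CARD('a) - 1) * \<Prod>?N"
    using prod.distrib[of "\<lambda>_. -1" "\<lambda>a. a" ?N] cardN by simp
  finally show ?thesis
    using finite_field_power_card_minus_1[of "-1 :: 'a"] by simp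
qed

text \<open>By Wilson, the inverse of the product over \<open>X - {y}\<close> is
  \<open>- poly p y\<close>, where \<open>p\<close> has its roots on the complement of
  \<open>X\<close>. The cardinality condition says that \<open>degree p = card Y - 1\<close>, so the
  divided difference is the leading coefficient of \<open>p\<close>. Its sign cancels the one from
  replacing \<open>u - y\<close> by \<open>y - u\<close>; the remaining \<open>-1\<close> is
  Wilson's.\<close>

lemma sum_inverse_root_differences:
  fixes X Y :: "'a::{field,finite} set"
  assumes YX: "Y \<subseteq> X" and card: "card X + card Y = CARD('a) + 1"
  shows "(\<Sum>y\<in>Y. inverse ((\<Prod>x\<in>X - {y}. x - y) * (\<Prod>u\<in>Y - {y}. u - y))) = -1"
proof -
  define p :: "'a poly" where "p = (\<Prod>a\<in>-X. [:a, -1:])"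
  have cX: "card (-X) = CARD('a) - card X" "card X \<le> CARD('a)"
    by (simp_all add: Compl_eq_Diff_UNIV card_Diff_subset card_mono)
  have degp: "degree p = card Y - 1"
    unfolding p_def using cX card by (subst degree_prod_eq_sum_degree) auto
  have leadp: "lead_coeff p = (-1) ^ (card Y - 1)"
    proof -
    have "card Y - 1 = card (-X)" using cX card by linarith
    then show ?thesis unfolding p_def by (simp add: lead_coeff_prod)
  qed
  have "inverse ((\<Prod>x\<in>X - {y}. x - y) * (\<Prod>u\<in>Y - {y}. u - y))
      = - ((-1) ^ (card Y - 1)) * (poly p y / (\<Prod>u\<in>Y - {y}. y - u))" if y: "y \<in> Y" for y
  proof -
    have "(\<Prod>x\<in>UNIV - {y}. x - y) = \<Prod>(UNIV - {0})"
      by (rule prod.reindex_bij_witness[of _ "\<lambda>z. z + y" "\<lambda>x. x - y"]) auto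
    then have wil: "(\<Prod>x\<in>UNIV - {y}. x - y) = -1"
      by (simp add: finite_field_wilson)
    have un: "UNIV - {y} = (X - {y}) \<union> -X" using y YX by auto
    have "(\<Prod>x\<in>X - {y}. x - y) * (\<Prod>x\<in>-X. x - y) = -1"
      unfolding wil[symmetric] un by (rule prod.union_disjoint[symmetric]) auto
    moreover have "poly p y = (\<Prod>x\<in>-X. x - y)" by (simp add: p_def poly_prod)
    ultimately have "(\<Prod>x\<in>X - {y}. x - y) * poly p y = -1" by simp
    then have 1: "inverse (\<Prod>x\<in>X - {y}. x - y) = - poly p y"
      by (metis inverse_unique mult_minus_right minus_minus)
    have "(\<Prod>u\<in>Y - {y}. u - y) = (\<Prod>u\<in>Y - {y}. (-1) * (y - u))" by simp
    also have "\<dots> = (-1) ^ (card Y - 1) * (\<Prod>u\<in>Y - {y}. y - u)"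
      unfolding prod.distrib using y by (simp add: card_Diff_singleton)
    finally have 2: "inverse (\<Prod>u\<in>Y - {y}. u - y)
        = (-1) ^ (card Y - 1) / (\<Prod>u\<in>Y - {y}. y - u)"
      by (simp add: field_simps power_inverse[symmetric] del: power_inverse)
    show ?thesis unfolding inverse_mult_distrib 1 2 by simp
  qed
  then have "(\<Sum>y\<in>Y. inverse ((\<Prod>x\<in>X - {y}. x - y) * (\<Prod>u\<in>Y - {y}. u - y)))
      = - ((-1) ^ (card Y - 1)) * (\<Sum>y\<in>Y. poly p y / (\<Prod>u\<in>Y - {y}. y - u))"
    unfolding sum_distrib_left by (intro sum.cong) auto
  also have "(\<Sum>y\<in>Y. poly p y / (\<Prod>u\<in>Y - {y}. y - u)) = coeff p (card Y - 1)"
    using degp cX card by (intro sum_divided_differences) auto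
  also have "\<dots> = (-1) ^ (card Y - 1)" using leadp degp by simp
  finally show ?thesis by (simp add: power_mult_distrib[symmetric])
qed

text \<open>The abstract form of the sum on the projective line: \<open>b x y\<close> stands for the
  bracket of two points. Sending one point of \<open>E\<close> to infinity lowers both cardinalities
  by one, so \<open>q + 3\<close> becomes the \<open>q + 1\<close> of the affine sum.\<close>

lemma sum_inverse_brackets:
  fixes b :: "'b \<Rightarrow> 'b \<Rightarrow> 'a::{field,finite}"
  assumes fin: "finite V" and EV: "E \<subseteq> V" and E: "E \<noteq> {}" and V: "2 \<le> card V"
    and card: "card V + card E = CARD('a) + 3"
    and alt: "\<And>x. x \<in> V \<Longrightarrow> b x x = 0"
    and skew: "\<And>x y. x \<in> V \<Longrightarrow> y \<in> V \<Longrightarrow> b x y = - b y x"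
    and nz: "\<And>x y. x \<in> V \<Longrightarrow> y \<in> V \<Longrightarrow> x \<noteq> y \<Longrightarrow> b x y \<noteq> 0"
    and pluecker: "\<And>x y w e. x \<in> V \<Longrightarrow> y \<in> V \<Longrightarrow> w \<in> V \<Longrightarrow> e \<in> V \<Longrightarrow>
      b x y * b w e - b x w * b y e + b x e * b y w = 0"
  shows "(\<Sum>e\<in>E. inverse ((\<Prod>s\<in>V - {e}. b s e) * (\<Prod>u\<in>E - {e}. b u e))) = 0"
proof -
  obtain z where z: "z \<in> E" using E by blast
  then have zV: "z \<in> V" using EV by blast
  have finE: "finite E" using fin EV finite_subset by blast
  have "card (V - {z}) \<noteq> 0" using V zV fin by simp
  then have "V - {z} \<noteq> {}" by (metis card.empty)
  \<comment> \<open>\<open>w\<close> serves as the origin of the affine coordinate: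
    \<open>a w = 0\<close> below.\<close>
  then obtain w where w: "w \<in> V" "w \<noteq> z" by blast
  define V' E' where "V' = V - {z}" and "E' = E - {z}"
  have sub: "E' \<subseteq> V'" "finite V'" "finite E'" using EV fin finE by (auto simp: V'_def E'_def)
  \<comment> \<open>The affine coordinate on the projective line that sends \<open>z\<close> to infinity.\<close>
  define a where "a = (\<lambda>x. b x w / (b x z * b w z))"
  \<comment> \<open>This is the Pluecker relation for \<open>x\<close>, \<open>y\<close>,
    \<open>w\<close>, \<open>z\<close>, divided by \<open>b w z\<close>.\<close>
  have diff: "b x y = b x z * b y z * (a x - a y)" if "x \<in> V'" "y \<in> V'" for x y
  proof -
    have "b w z \<noteq> 0" "b x z \<noteq> 0" "b y z \<noteq> 0" "x \<in> V" "y \<in> V"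
      using that nz zV w by (auto simp: V'_def)
    then show ?thesis
      using pluecker[of x y w z] zV w by (simp add: a_def divide_simps) (simp add: algebra_simps)
  qed
  have bz: "b x z \<noteq> 0" if "x \<in> V'" for x using that nz zV by (auto simp: V'_def)
  have inj: "inj_on a V'"
  proof (rule inj_onI, rule ccontr)
    fix x y assume "x \<in> V'" "y \<in> V'" "a x = a y" "x \<noteq> y"
    then show False using diff[of x y] nz[of x y] by (auto simp: V'_def)
  qed
  then have injE: "inj_on a E'" using sub(1) inj_on_subset by blast
  have cV: "card V' = card V - 1" "card E' = card E - 1" "card E > 0"
    using zV z finE fin E by (auto simp: V'_def E'_def card_gt_0_iff)
  define P Q where "P = (\<Prod>s\<in>V'. b s z)" and "Q = (\<Prod>u\<in>E'. b u z)"
  \<comment> \<open>\<open>P\<close> and \<open>Q\<close> do not depend on \<open>e\<close>, so each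
    remaining term is a constant times a term of the affine sum.\<close>
  have key: "(\<Prod>s\<in>V - {e}. b s e) * (\<Prod>u\<in>E - {e}. b u e)
      = P * Q * ((\<Prod>x\<in>a ` V' - {a e}. x - a e) * (\<Prod>u\<in>a ` E' - {a e}. u - a e))"
    if e: "e \<in> E'" for e
  proof -
    have eV: "e \<in> V'" using e sub by blast
    \<comment> \<open>The extra factor \<open>b e z\<close> on the left completes the product over
      \<open>W - {z}\<close>, which includes \<open>s = e\<close>. The minus sign comes from
      \<open>b z e\<close> and disappears when the instances \<open>W = V\<close> and
      \<open>W = E\<close> are multiplied.\<close>
    have gen: "(\<Prod>s\<in>W - {e}. b s e) * b e z = - ((\<Prod>s\<in>W - {z}. b s z) * b e z ^ (card W - 1)
        * (\<Prod>x\<in>a ` (W - {z}) - {a e}. x - a e))"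
      if W: "W \<subseteq> V" "z \<in> W" "e \<in> W" for W
    proof -
      have finW: "finite W" using W fin finite_subset by blast
      let ?R = "W - {z} - {e}"
      have ez: "e \<noteq> z" using eV by (auto simp: V'_def)
      have cR: "card W - 1 = Suc (card ?R)"
      proof -
        have "card (W - {z}) = card W - 1" using W finW by simp
        moreover have "card (W - {z}) = Suc (card ?R)"
          using W finW ez by (intro card.remove) auto
        ultimately show ?thesis by simp
      qed
      have im: "a ` (W - {z}) - {a e} = a ` ?R" "inj_on a ?R"
        using inj W(1,3) ez by (auto simp: V'_def inj_on_def)
      have "(\<Prod>s\<in>W - {e}. b s e) = b z e * (\<Prod>s\<in>?R. b s e)"
      proof -
        have "W - {e} - {z} = ?R" by blast
        then show ?thesis using prod.remove[of "W - {e}" z "\<lambda>s. b s e"] W finW ez by simp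
      qed
      also have "(\<Prod>s\<in>?R. b s e) = (\<Prod>s\<in>?R. b s z * b e z * (a s - a e))"
        using W(1) eV by (intro prod.cong refl diff) (auto simp: V'_def)
      also have "\<dots> = (\<Prod>s\<in>?R. b s z) * b e z ^ card ?R * (\<Prod>s\<in>?R. a s - a e)"
        by (simp add: prod.distrib)
      also have "(\<Prod>s\<in>?R. a s - a e) = (\<Prod>x\<in>a ` (W - {z}) - {a e}. x - a e)"
        unfolding im by (simp add: prod.reindex[OF im(2)])
      also have "b z e = - b e z" by (rule skew) (use eV zV in \<open>auto simp: V'_def\<close>)
      finally have 1: "(\<Prod>s\<in>W - {e}. b s e) = - b e z * ((\<Prod>s\<in>?R. b s z) * b e z ^ card ?R
         * (\<Prod>x\<in>a ` (W - {z}) - {a e}. x - a e))" .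
      have 2: "(\<Prod>s\<in>W - {z}. b s z) = b e z * (\<Prod>s\<in>?R. b s z)"
        using prod.remove[of "W - {z}" e "\<lambda>s. b s z"] W finW ez by simp
      show ?thesis unfolding 1 2 cR by simp
    qed
    have be: "b e z \<noteq> 0" using bz eV by blast
    \<comment> \<open>The exponents add up to \<open>q + 1\<close>, and
      \<open>b e z ^ (q + 1)\<close> is the square of \<open>b e z\<close>, which cancels the two
      factors added by \<open>gen\<close>.\<close>
    have c: "(card V - 1) + (card E - 1) = CARD('a) + 1" using card cV V by linarith
    have pw: "b e z ^ (card V - 1) * b e z ^ (card E - 1) = b e z * b e z"
      unfolding power_add[symmetric] c by (simp add: finite_field_power_card)
    have e': "e \<in> E" "e \<in> V" using e eV by (auto simp: V'_def E'_def)
    have "((\<Prod>s\<in>V - {e}. b s e) * b e z) * ((\<Prod>u\<in>E - {e}. b u e) * b e z)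
        = P * Q * ((\<Prod>x\<in>a ` V' - {a e}. x - a e) * (\<Prod>u\<in>a ` E' - {a e}. u - a e))
          * (b e z ^ (card V - 1) * b e z ^ (card E - 1))"
      using gen[of V] gen[of E] z zV e' EV by (simp add: P_def Q_def V'_def E'_def)
    then show ?thesis unfolding pw using be by simp
  qed
  \<comment> \<open>The term at \<open>z\<close> is \<open>inverse (P * Q)\<close>; the affine sum
    \<open>-1\<close> makes the other terms add up to its negative.\<close>
  have "(\<Sum>e\<in>E. inverse ((\<Prod>s\<in>V - {e}. b s e) * (\<Prod>u\<in>E - {e}. b u e)))
      = inverse (P * Q) + (\<Sum>e\<in>E'. inverse ((\<Prod>s\<in>V - {e}. b s e) * (\<Prod>u\<in>E - {e}. b u e)))"
    using sum.remove[OF finE z] by (simp add: P_def Q_def V'_def E'_def)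
  also have "(\<Sum>e\<in>E'. inverse ((\<Prod>s\<in>V - {e}. b s e) * (\<Prod>u\<in>E - {e}. b u e)))
      = inverse (P * Q) * (\<Sum>e\<in>E'. inverse ((\<Prod>x\<in>a ` V' - {a e}. x - a e)
          * (\<Prod>u\<in>a ` E' - {a e}. u - a e)))"
    unfolding sum_distrib_left by (intro sum.cong refl) (simp add: key)
  also have "(\<Sum>e\<in>E'. inverse ((\<Prod>x\<in>a ` V' - {a e}. x - a e) * (\<Prod>u\<in>a ` E' - {a e}. u - a e)))
      = (\<Sum>y\<in>a ` E'. inverse ((\<Prod>x\<in>a ` V' - {y}. x - y) * (\<Prod>u\<in>a ` E' - {y}. u - y)))"
    by (simp add: sum.reindex[OF injE])
  also have "\<dots> = -1"
  proof (rule sum_inverse_root_differences)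
    show "a ` E' \<subseteq> a ` V'" using sub by blast
    show "card (a ` V') + card (a ` E') = CARD('a) + 1"
      using cV card V by (simp add: card_image inj injE)
  qed
  finally show ?thesis by simp
qed

subsection \<open>Determinants with a prescribed list of rows\<close>

text \<open>Rank \<open>n\<close> yields \<open>n\<close> independent columns. They form an
  invertible matrix whose transpose kills \<open>v\<close>.\<close>

lemma (in vec_space) full_rank_left_kernel:
  assumes A: "A \<in> carrier_mat n nc" and rk: "rank A = n" and v: "v \<in> carrier_vec n"
    and orth: "\<And>j. j < nc \<Longrightarrow> col A j \<bullet> v = 0"
  shows "v = 0\<^sub>v n"
proof -
  have "lin_indpt ({} :: 'a vec set)" by (simp add: lin_dep_def)
  then obtain S where S: "maximal S (\<lambda>T. T \<subseteq> set (cols A) \<and> lin_indpt T)" "finite S"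
    using maximal_exists_superset[of "set (cols A)" "\<lambda>T. T \<subseteq> set (cols A) \<and> lin_indpt T" "{}"]
    by auto
  have SA: "S \<subseteq> set (cols A)" "lin_indpt S" using S by (auto simp: maximal_def)
  have "card S = n" using rank_card_indpt[OF A S(1)] rk by simp
  then obtain cs where cs: "set cs = S" "distinct cs" "length cs = n"
    using finite_distinct_list[OF S(2)] distinct_card by metis
  have colsA: "set (cols A) \<subseteq> carrier_vec n" using A cols_dim by blast
  define M where "M = mat_of_cols n cs"
  have M: "M \<in> carrier_mat n n" using cs by (auto simp: M_def)
  have cM: "cols M = cs" unfolding M_def using cs SA colsA by (intro cols_mat_of_cols) auto
  have "rank M = n" using lin_indpt_full_rank[OF M] cM cs SA by simp
  then have "det M \<noteq> 0" using det_rank_iff[OF M] by simp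
  then have detT: "det M\<^sup>T \<noteq> 0" using det_transpose[OF M] by simp
  have "M\<^sup>T *\<^sub>v v = 0\<^sub>v n"
  proof (rule eq_vecI)
    fix i assume i: "i < dim_vec (0\<^sub>v n)"
    have "col M i \<in> set (cols M)" using i M by (auto simp: cols_def)
    then have "col M i \<in> set (cols A)" using cM cs SA by auto
    then obtain j where "j < nc" "col M i = col A j" using A by (auto simp: cols_def)
    then show "(M\<^sup>T *\<^sub>v v) $ i = 0\<^sub>v n $ i" using orth i M by auto
  qed (use M in auto)
  then show ?thesis
    using det_0_iff_vec_prod_zero[of "M\<^sup>T" n] detT v M by auto
qed

lemma basis_family_length_det:
  fixes T :: "'a::field vec list"
  assumes "basis_family k T"
  shows "set T \<subseteq> carrier_vec k" "length T = k" "det (mat_of_rows k T) \<noteq> 0"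
proof -
  interpret vec_space "TYPE('a)" k .
  have T: "distinct T" "basis (set T)" using assms by (auto simp: basis_family_def)
  then show carr: "set T \<subseteq> carrier_vec k" by (auto simp: basis_def)
  have li: "lin_indpt (set T)" using T by (auto simp: basis_def)
  show len: "length T = k"
    using dim_basis[OF _ T(2)] dim_is_n distinct_card[OF T(1)] by simp
  have M: "mat_of_cols k T \<in> carrier_mat k k" using len by auto
  have "cols (mat_of_cols k T) = T" using carr by (rule cols_mat_of_cols)
  then have "rank (mat_of_cols k T) = k" using lin_indpt_full_rank[OF M] T li by simp
  then have "det (mat_of_cols k T) \<noteq> 0" using det_rank_iff[OF M] by simp
  then show "det (mat_of_rows k T) \<noteq> 0"
    using det_transpose[OF M] by (simp add: transpose_mat_of_cols)
qed

text \<open>The description defining \<open>coords\<close> has exactly one solution because the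
  basis matrix is invertible.\<close>

lemma coords_solves:
  assumes B: "basis_family k B" and u: "u \<in> carrier_vec k"
  shows "coords k B u \<in> carrier_vec k" "mat_of_cols k B *\<^sub>v coords k B u = u"
proof -
  let ?M = "mat_of_cols k B"
  have M: "?M \<in> carrier_mat k k" using basis_family_length_det(2)[OF B] by auto
  have R: "mat_of_rows k B \<in> carrier_mat k k" using basis_family_length_det(2)[OF B] by auto
  have "det ?M \<noteq> 0"
    using basis_family_length_det(3)[OF B] det_transpose[OF R] by (simp add: transpose_mat_of_rows)
  then obtain N where N: "N \<in> carrier_mat k k" "N * ?M = 1\<^sub>m k" "?M * N = 1\<^sub>m k"
    using det_non_zero_imp_unit[OF M, of undefined] by (auto simp: Units_def ring_mat_def)
  have "\<exists>!c. c \<in> carrier_vec k \<and> ?M *\<^sub>v c = u"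
  proof (rule ex1I[of _ "N *\<^sub>v u"])
    have "?M *\<^sub>v (N *\<^sub>v u) = (?M * N) *\<^sub>v u"
      using M N u by (intro assoc_mult_mat_vec[symmetric]) auto
    then show "N *\<^sub>v u \<in> carrier_vec k \<and> ?M *\<^sub>v (N *\<^sub>v u) = u" using N u by auto
  next
    fix c assume c: "c \<in> carrier_vec k \<and> ?M *\<^sub>v c = u"
    have "(N * ?M) *\<^sub>v c = N *\<^sub>v (?M *\<^sub>v c)" using M N c by (intro assoc_mult_mat_vec) auto
    then show "c = N *\<^sub>v u" using N c by auto
  qed
  from theI'[OF this] show "coords k B u \<in> carrier_vec k" "?M *\<^sub>v coords k B u = u"
    by (auto simp: coords_def)
qed

lemma mat_of_rows_coords:
  fixes B :: "'a::field vec list"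
  assumes B: "basis_family k B" and L: "set L \<subseteq> carrier_vec k"
  shows "mat_of_rows k L = mat_of_rows k (map (coords k B) L) * mat_of_rows k B"
    (is "_ = ?X * ?R")
proof (rule eq_matI)
  have lenB: "length B = k" by (rule basis_family_length_det[OF B])
  fix i j assume "i < dim_row (?X * ?R)" "j < dim_col (?X * ?R)"
  then have ij: "i < length L" "j < k" by auto
  have Li: "L ! i \<in> carrier_vec k" using ij L nth_mem by blast
  have co: "coords k B (L ! i) \<in> carrier_vec k" by (rule coords_solves(1)[OF B Li])
  have rowX: "row ?X i = coords k B (L ! i)"
    using ij co by (intro eq_vecI) (auto simp: mat_of_rows_index)
  have colR: "col ?R j = row (mat_of_cols k B) j"
    using ij lenB by (intro eq_vecI) (auto simp: mat_of_rows_index mat_of_cols_index)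
  have rowC: "row (mat_of_cols k B) j \<in> carrier_vec k"
    by (rule carrier_vecI) (simp add: lenB)
  have "(?X * ?R) $$ (i, j) = row ?X i \<bullet> col ?R j"
    using ij by (intro index_mult_mat(1)) simp_all
  also have "\<dots> = row (mat_of_cols k B) j \<bullet> coords k B (L ! i)"
    unfolding rowX colR by (rule comm_scalar_prod[OF co rowC])
  also have "\<dots> = (mat_of_cols k B *\<^sub>v coords k B (L ! i)) $ j"
    using ij by (intro index_mult_mat_vec[symmetric]) simp
  also have "\<dots> = L ! i $ j" by (simp only: coords_solves(2)[OF B Li])
  also have "\<dots> = mat_of_rows k L $$ (i, j)" using ij by (simp add: mat_of_rows_index)
  finally show "mat_of_rows k L $$ (i, j) = (?X * ?R) $$ (i, j)" ..
qed auto

text \<open>Multiplicativity of the determinant: \<open>B\<close> enters only through one nonzero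
  factor common to all \<open>u\<close> and \<open>C\<close>, so identities can be proved in
  standard coordinates.\<close>

lemma det_wrt_eq_det_rows:
  fixes B :: "'a::field vec list"
  assumes B: "basis_family k B" and len: "Suc (length C) = k"
    and carr: "u \<in> carrier_vec k" "set C \<subseteq> carrier_vec k"
  shows "det_wrt k B u C = det (mat_of_rows k (u # C)) / det (mat_of_rows k B)"
proof -
  have R: "mat_of_rows k B \<in> carrier_mat k k"
    by (rule carrier_matI) (simp_all add: basis_family_length_det(2)[OF B])
  have X: "mat_of_rows k (map (coords k B) (u # C)) \<in> carrier_mat k k"
    by (rule carrier_matI) (simp_all add: len)
  have "mat_of_rows k (u # C) = mat_of_rows k (map (coords k B) (u # C)) * mat_of_rows k B"
    using carr by (intro mat_of_rows_coords[OF B]) auto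
  then have "det (mat_of_rows k (u # C)) = det_wrt k B u C * det (mat_of_rows k B)"
    unfolding det_wrt_def by (simp only: det_mult[OF X R])
  then show ?thesis using basis_family_length_det(3)[OF B] by simp
qed

section \<open>Signs under reordering of rows\<close>

lemma det_rows_swap_adjacent:
  fixes x y :: "'a::comm_ring_1 vec"
  assumes "length p + length q + 2 = k"
  shows "det (mat_of_rows k (p @ x # y # q)) = - det (mat_of_rows k (p @ y # x # q))"
proof -
  let ?M = "mat_of_rows k (p @ y # x # q)"
  have "mat_of_rows k (p @ x # y # q) = swaprows (length p) (Suc (length p)) ?M"
    using assms by (intro eq_matI) (auto simp: mat_of_rows_index nth_append nth_Cons split: nat.splits)
  moreover have "?M \<in> carrier_mat k k" using assms by auto
  ultimately show ?thesis using det_swaprows[of "length p" k "Suc (length p)" ?M] assms by simp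
qed

lemma det_rows_move_to_front:
  fixes x :: "'a::comm_ring_1 vec"
  assumes "length p + length xs + length ys + 1 = k"
  shows "det (mat_of_rows k (p @ xs @ x # ys))
    = (-1) ^ length xs * det (mat_of_rows k (p @ x # xs @ ys))"
  using assms
proof (induction xs arbitrary: p)
  case (Cons a xs)
  have "det (mat_of_rows k (p @ (a # xs) @ x # ys))
      = (-1) ^ length xs * det (mat_of_rows k (p @ a # x # xs @ ys))"
    using Cons.IH[of "p @ [a]"] Cons.prems by simp
  also have "det (mat_of_rows k (p @ a # x # xs @ ys)) = - det (mat_of_rows k (p @ x # a # xs @ ys))"
    using Cons.prems by (intro det_rows_swap_adjacent) auto
  finally show ?case by simp
qed simp

text \<open>The sign depends only on the two tails, not on the rows in front of them.\<close>

lemma det_rows_mset_eq: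
  fixes L L' :: "'a::comm_ring_1 vec list"
  assumes "mset L = mset L'"
  obtains s :: 'a where "s = 1 \<or> s = -1"
    and "\<And>p. length p + length L = k \<Longrightarrow>
      det (mat_of_rows k (p @ L)) = s * det (mat_of_rows k (p @ L'))"
proof -
  \<comment> \<open>With \<open>p\<close> quantified after \<open>s\<close>, the induction can
    absorb the head \<open>a\<close> into the prefix \<open>p @ [a]\<close>.\<close>
  have "\<exists>s :: 'a. (s = 1 \<or> s = -1) \<and> (\<forall>p. length p + length L = k \<longrightarrow>
      det (mat_of_rows k (p @ L)) = s * det (mat_of_rows k (p @ L')))"
    using assms
  proof (induction L arbitrary: L')
    case (Cons a L)
    then have "a \<in> set L'" by (metis list.set_intros(1) set_mset_mset)
    then obtain xs ys where L': "L' = xs @ a # ys" by (meson split_list)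
    have ms: "mset L = mset (xs @ ys)" using Cons.prems L' by simp
    from Cons.IH[OF ms] obtain s :: 'a where s: "s = 1 \<or> s = -1"
      "\<And>p. length p + length L = k \<Longrightarrow>
        det (mat_of_rows k (p @ L)) = s * det (mat_of_rows k (p @ xs @ ys))"
      by auto
    have len: "length L = length xs + length ys" using mset_eq_length[OF ms] by simp
    let ?s = "s * (-1) ^ length xs"
    have "det (mat_of_rows k (p @ a # L)) = ?s * det (mat_of_rows k (p @ L'))"
      if "length p + length (a # L) = k" for p
    proof -
      have "det (mat_of_rows k (p @ L'))
          = (-1) ^ length xs * det (mat_of_rows k (p @ a # xs @ ys))"
        unfolding L' using that len by (intro det_rows_move_to_front) auto
      moreover have "(-1) ^ length xs * ((-1) ^ length xs :: 'a) = 1"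
        by (simp flip: power_mult_distrib)
      ultimately have "(-1) ^ length xs * det (mat_of_rows k (p @ L'))
          = det (mat_of_rows k (p @ a # xs @ ys))"
        by (simp flip: mult.assoc)
      then show ?thesis using s(2)[of "p @ [a]"] that by (simp add: mult.assoc)
    qed
    moreover have "?s = 1 \<or> ?s = -1" using s(1) by (cases "even (length xs)") auto
    ultimately show ?case by blast
  qed auto
  then show ?thesis using that by blast
qed

lemma det_rows_not_distinct:
  fixes L :: "'a::comm_ring_1 vec list"
  assumes "length L = k" "\<not> distinct L"
  shows "det (mat_of_rows k L) = 0"
proof -
  obtain i j where "i < length L" "j < length L" "i \<noteq> j" "L ! i = L ! j"
    using assms(2) by (auto simp: distinct_conv_nth)
  then show ?thesis using assms(1)
    by (intro det_identical_rows[of _ k i j]) (auto intro!: eq_vecI simp: mat_of_rows_index)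
qed

section \<open>Linearity in the first row and the Pluecker relation\<close>

lemma det_rows_linear_head:
  fixes L :: "'a::comm_ring_1 vec list"
  assumes "Suc (length L) = k"
  obtains f where "f \<in> carrier_vec k"
    and "\<And>x. x \<in> carrier_vec k \<Longrightarrow> det (mat_of_rows k (x # L)) = x \<bullet> f"
proof
  \<comment> \<open>Cofactors along the first row ignore that row, so the zero vector is only a
    placeholder.\<close>
  let ?f = "vec k (\<lambda>j. cofactor (mat_of_rows k (0\<^sub>v k # L)) 0 j)"
  show "?f \<in> carrier_vec k" by simp
  fix x :: "'a vec" assume x: "x \<in> carrier_vec k"
  let ?M = "mat_of_rows k (x # L)"
  have "mat_delete ?M 0 j = mat_delete (mat_of_rows k (0\<^sub>v k # L)) 0 j" for j
    using assms by (intro eq_matI) (auto simp: mat_delete_def mat_of_rows_index)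
  then have cof: "cofactor ?M 0 j = cofactor (mat_of_rows k (0\<^sub>v k # L)) 0 j" for j
    by (simp add: cofactor_def)
  have "det ?M = (\<Sum>j<k. ?M $$ (0, j) * cofactor ?M 0 j)"
    using assms by (intro laplace_expansion_row) (auto intro!: carrier_matI)
  also have "\<dots> = x \<bullet> ?f"
    using x assms by (auto simp: scalar_prod_def cof lessThan_atLeast0 mat_of_rows_index intro!: sum.cong)
  finally show "det ?M = x \<bullet> ?f" .
qed

text \<open>The left side is linear in \<open>x\<close>, hence of the form
  \<open>x \<bullet> F\<close>. It vanishes at \<open>w\<close>, at \<open>e\<close> and on
  \<open>A\<close>, which are the rows of an invertible matrix, so \<open>F\<close> is zero.\<close>

lemma det_rows_pluecker:
  fixes A :: "'a::idom vec list"
  assumes len: "length A + 2 = k" and A: "set A \<subseteq> carrier_vec k"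
    and x: "x \<in> carrier_vec k" and w: "w \<in> carrier_vec k" and e: "e \<in> carrier_vec k"
    and nz: "det (mat_of_rows k (w # e # A)) \<noteq> 0"
  defines "b \<equiv> \<lambda>x y. det (mat_of_rows k (x # y # A))"
  shows "b x y * b w e - b x w * b y e + b x e * b y w = 0"
proof -
  have lens: "Suc (length (z # A)) = k" for z using len by simp
  obtain f where f: "f \<in> carrier_vec k" "\<And>x. x \<in> carrier_vec k \<Longrightarrow> b x y = x \<bullet> f"
    using det_rows_linear_head[OF lens[of y]] unfolding b_def by metis
  obtain g where g: "g \<in> carrier_vec k" "\<And>x. x \<in> carrier_vec k \<Longrightarrow> b x w = x \<bullet> g"
    using det_rows_linear_head[OF lens[of w]] unfolding b_def by metis
  obtain h where h: "h \<in> carrier_vec k" "\<And>x. x \<in> carrier_vec k \<Longrightarrow> b x e = x \<bullet> h"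
    using det_rows_linear_head[OF lens[of e]] unfolding b_def by metis
  define F where "F = b w e \<cdot>\<^sub>v f + (- b y e) \<cdot>\<^sub>v g + b y w \<cdot>\<^sub>v h"
  have F: "F \<in> carrier_vec k" using f g h by (simp add: F_def)
  have eval: "v \<bullet> F = b v y * b w e - b v w * b y e + b v e * b y w" if "v \<in> carrier_vec k" for v
    using that f g h by (simp add: F_def scalar_prod_add_distrib[of _ k] algebra_simps)
  have skew: "b u v = - b v u" for u v
    unfolding b_def using det_rows_swap_adjacent[of "[]" A k u v] len by simp
  have alt: "b u u = 0" for u
    unfolding b_def using len by (intro det_rows_not_distinct) auto
  have mem: "b u v = 0" if "u \<in> set A" for u v
    unfolding b_def using len that by (intro det_rows_not_distinct) auto
  let ?M = "mat_of_rows k (w # e # A)"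
  have M: "?M \<in> carrier_mat k k" using len by (auto intro!: carrier_matI)
  have rows: "v \<bullet> F = 0" if v: "v \<in> set (w # e # A)" for v
  proof -
    consider "v = w" | "v = e" | "v \<in> set A" using v by auto
    then show ?thesis
    proof cases
      case 1
      then show ?thesis using eval[OF w] skew[of w y] by (simp add: alt)
    next
      case 2
      then show ?thesis using eval[OF e] skew[of e y] skew[of e w] by (simp add: alt)
    next
      case 3
      then show ?thesis using eval[of v] A by (auto simp: mem)
    qed
  qed
  have "?M *\<^sub>v F = 0\<^sub>v k"
  proof (rule eq_vecI)
    fix i assume "i < dim_vec (0\<^sub>v k :: 'a vec)"
    then have i: "i < length (w # e # A)" using len by simp
    have "(w # e # A) ! i \<in> set (w # e # A)" using i nth_mem by blast
    moreover have "set (w # e # A) \<subseteq> carrier_vec k" using w e A by auto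
    ultimately have "row ?M i = (w # e # A) ! i" "(w # e # A) ! i \<bullet> F = 0"
      using i rows by (auto intro!: mat_of_rows_row)
    then show "(?M *\<^sub>v F) $ i = 0\<^sub>v k $ i" using i len by simp
  qed (use len in simp)
  then have "F = 0\<^sub>v k" using det_0_iff_vec_prod_zero[OF M] nz F by blast
  then show ?thesis using eval[OF x] x by simp
qed

section \<open>Arcs in terms of determinants\<close>

lemma is_arc_det_nonzero:
  fixes S :: "'a::field vec list"
  assumes arc: "is_arc k S" and L: "distinct L" "set L \<subseteq> set S" "length L = k"
    and dS: "distinct S"
  shows "det (mat_of_rows k L) \<noteq> 0"
proof -
  \<comment> \<open>The arc condition speaks only of rows in the order of \<open>S\<close>. Sorting
    \<open>L\<close> into that order changes the determinant at most by a sign.\<close>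
  let ?T = "filter (\<lambda>x. x \<in> set L) S"
  have "set ?T = set L" "distinct ?T" using L dS by auto
  then have ms: "mset ?T = mset L" using L(1) by (blast intro: set_eq_iff_mset_eq_distinct[THEN iffD1])
  then have "length ?T = k" using L mset_eq_length by metis
  then have "basis_family k ?T" using arc by (simp add: is_arc_def)
  then have nz: "det (mat_of_rows k ?T) \<noteq> 0" by (rule basis_family_length_det)
  obtain s :: 'a where "s = 1 \<or> s = -1"
    "det (mat_of_rows k ([] @ ?T)) = s * det (mat_of_rows k ([] @ L))"
    using det_rows_mset_eq[OF ms, of k] \<open>length ?T = k\<close> by (metis add.left_neutral list.size(3))
  then show ?thesis using nz by auto
qed

lemma set_nths_eq_image:
  assumes "I \<subseteq> {..<length xs}"
  shows "set (nths xs I) = (!) xs ` I"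
  using assms by (auto simp: set_nths)

lemma length_nths_eq_card:
  assumes "I \<subseteq> {..<length xs}"
  shows "length (nths xs I) = card I"
proof -
  have "{i. i < length xs \<and> i \<in> I} = I" using assms by auto
  then show ?thesis by (simp add: length_nths)
qed

text \<open>Two positions with equal entries would extend to \<open>k\<close> positions, whose
  entries cannot form a basis. For \<open>k = 1\<close> this fails: a nonzero scalar may be
  repeated.\<close>

lemma is_arc_distinct:
  fixes S :: "'a::field vec list"
  assumes arc: "is_arc k S" and k: "2 \<le> k"
  shows "distinct S"
proof (rule ccontr)
  assume "\<not> distinct S"
  then obtain i j where ij: "i < length S" "j < length S" "i \<noteq> j" "S ! i = S ! j"
    by (auto simp: distinct_conv_nth)
  have "card {i, j} \<le> k" "k \<le> card {..<length S}" "{i, j} \<subseteq> {..<length S}"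
    using ij k arc by (auto simp: is_arc_def)
  then obtain I where I: "{i, j} \<subseteq> I" "I \<subseteq> {..<length S}" "card I = k"
    by (metis exists_subset_between finite_lessThan)
  have len: "length (nths S I) = k" using I by (simp add: length_nths_eq_card)
  then have "basis_family k (nths S I)" using arc by (meson is_arc_def subseq_conv_nths)
  then have "card (set (nths S I)) = k" using len by (auto simp: basis_family_def distinct_card)
  moreover have "set (nths S I) = (!) S ` I" using I(2) by (rule set_nths_eq_image)
  ultimately have "inj_on ((!) S) I" using I finite_subset[OF I(2)] by (intro eq_card_imp_inj_on) auto
  then show False using ij I by (auto simp: inj_on_def)
qed

subsection \<open>The left kernel of the arc matrix\<close>

text \<open>Modulo the span of \<open>a\<close> the vectors of \<open>S\<close> outside
  \<open>a\<close> are pairwise independent in a plane; their bracket is the determinant with tail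
  \<open>a\<close>.\<close>

lemma arc_bracket_sum:
  fixes S B a :: "'a::{field,finite} vec list" and k :: nat
  assumes arc: "is_arc k S" and B: "basis_family k B"
    and a: "distinct a" "set a \<subseteq> set S" "length a + 2 = k"
    and E: "E \<subseteq> set S - set a" "E \<noteq> {}" "card (set S - set a) + card E = CARD('a) + 3"
  shows "(\<Sum>e\<in>E. inverse ((\<Prod>s\<in>set S - set a - {e}. det_wrt k B s (e # a))
    * (\<Prod>u\<in>E - {e}. det_wrt k B u (e # a)))) = 0"
proof -
  have dS: "distinct S" using a(3) by (intro is_arc_distinct[OF arc]) simp
  have cS: "set S \<subseteq> carrier_vec k" "k \<le> length S" using arc by (auto simp: is_arc_def)
  have ca: "set a \<subseteq> carrier_vec k" using a cS by auto
  define r where "r = det (mat_of_rows k B)"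
  have r: "r \<noteq> 0" using basis_family_length_det[OF B] by (simp add: r_def)
  have d: "det_wrt k B x (y # a) = det (mat_of_rows k (x # y # a)) / r"
    if "x \<in> set S" "y \<in> set S" for x y
    unfolding r_def using that cS ca a by (intro det_wrt_eq_det_rows[OF B]) auto
  have nz: "det (mat_of_rows k (x # y # a)) \<noteq> 0"
    if "x \<in> set S - set a" "y \<in> set S - set a" "x \<noteq> y" for x y
    using that a by (intro is_arc_det_nonzero[OF arc _ _ _ dS]) auto
  have alt: "det (mat_of_rows k (x # x # a)) = 0" for x
    using a by (intro det_rows_not_distinct) auto
  have skew: "det (mat_of_rows k (x # y # a)) = - det (mat_of_rows k (y # x # a))" for x y
    using det_rows_swap_adjacent[of "[]" a k x y] a by simp
  show ?thesis
  proof (rule sum_inverse_brackets[where b = "\<lambda>x y. det_wrt k B x (y # a)"])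
    have "card (set S - set a) = length S - length a"
      using a dS by (simp add: card_Diff_subset distinct_card)
    then show "2 \<le> card (set S - set a)" using a cS by linarith
  next
    fix x y w e
    assume V: "x \<in> set S - set a" "y \<in> set S - set a" "w \<in> set S - set a" "e \<in> set S - set a"
    let ?b = "\<lambda>x y. det (mat_of_rows k (x # y # a))"
    have "?b x y * ?b w e - ?b x w * ?b y e + ?b x e * ?b y w = 0"
    \<comment> \<open>The Pluecker lemma needs \<open>w # e # a\<close> to be independent. If
      \<open>w = e\<close>, the first term is zero and the other two cancel.\<close>
    proof (cases "w = e")
      case False
      show ?thesis using V cS nz[OF V(3,4) False] a(3) ca
        by (intro det_rows_pluecker) auto
    qed (simp add: alt)
    then show "det_wrt k B x (y # a) * det_wrt k B w (e # a)
        - det_wrt k B x (w # a) * det_wrt k B y (e # a)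
        + det_wrt k B x (e # a) * det_wrt k B y (w # a) = 0"
      using V r by (simp add: d field_simps)
  next
    fix x y assume "x \<in> set S - set a" "y \<in> set S - set a"
    then show "det_wrt k B x (y # a) = - det_wrt k B y (x # a)"
      using skew[of x y] by (simp add: d)
  qed (use E nz alt r in \<open>auto simp: d\<close>)
qed

text \<open>Vectors of \<open>G\<close> outside \<open>C\<close> contribute twice; the second
  product is there to absorb the entry of a column, a product over \<open>U\<close>. Products over
  sets of vectors match products over positions because arcs have distinct entries for
  \<open>2 \<le> k\<close>.\<close>

definition kernel_weight ::
  "nat \<Rightarrow> 'a::field vec list \<Rightarrow> 'a vec list \<Rightarrow> 'a vec list \<Rightarrow> nat set \<Rightarrow> 'a" where
  "kernel_weight k B G S C =
     inverse ((\<Prod>s\<in>set S - set (nths G C). det_wrt k B s (nths G C))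
       * (\<Prod>u\<in>set G - set (nths G C). det_wrt k B u (nths G C)))"

context
  fixes G S B :: "'a::{field,finite} vec list" and k :: nat
  assumes k: "2 \<le> k" and arc: "is_arc k S" and B: "basis_family k B" and sub: "subseq G S"
begin

lemma distinct_G_S: "distinct S" "distinct G" "set G \<subseteq> set S" "set S \<subseteq> carrier_vec k"
proof -
  obtain N where "G = nths S N" using sub by (auto simp: subseq_conv_nths)
  then show "distinct S" "distinct G" "set G \<subseteq> set S" "set S \<subseteq> carrier_vec k"
    using is_arc_distinct[OF arc k] arc set_nths_subset[of S N]
    by (auto simp: is_arc_def distinct_nthsI)
qed

lemma det_wrt_nths_nonzero:
  assumes C: "C \<subseteq> {..<length G}" "card C + 1 = k" and s: "s \<in> set S - set (nths G C)"
  shows "det_wrt k B s (nths G C) \<noteq> 0"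
proof -
  have sC: "set (nths G C) \<subseteq> set S" using distinct_G_S set_nths_subset by fastforce
  have len: "length (nths G C) + 1 = k" using C by (simp add: length_nths_eq_card)
  have "det (mat_of_rows k (s # nths G C)) \<noteq> 0"
    using sC s len distinct_G_S by (intro is_arc_det_nonzero[OF arc]) (auto simp: distinct_nthsI)
  moreover have "det_wrt k B s (nths G C)
      = det (mat_of_rows k (s # nths G C)) / det (mat_of_rows k B)"
    using sC s len distinct_G_S by (intro det_wrt_eq_det_rows[OF B]) auto
  ultimately show ?thesis using basis_family_length_det[OF B] by simp
qed

lemma kernel_weight_nonzero:
  assumes "C \<subseteq> {..<length G}" "card C + 1 = k"
  shows "kernel_weight k B G S C \<noteq> 0"
  using det_wrt_nths_nonzero[OF assms] distinct_G_S(3)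
  by (auto simp: kernel_weight_def prod_zero_iff)

text \<open>Only the rows \<open>insert i A\<close> with \<open>i\<close> outside \<open>U\<close>
  and \<open>A\<close> meet the column. Their entries cancel against the weights, which leaves the
  bracket sum over \<open>E\<close>.\<close>

lemma column_orthogonal_kernel_weight:
  assumes U: "U \<subseteq> {..<length G}" and A: "A \<subseteq> {..<length G} - U" "card A + 2 = k"
    and lt: "card U + card A < length G"
    and cards: "length S + length G = CARD('a) + 2 * k - 1 + card U"
  shows "(\<Sum>C | C \<subseteq> {..<length G} \<and> card C + 1 = k.
    arc_entry k B G C (U, A) * kernel_weight k B G S C) = 0"
proof -
  note GS = distinct_G_S
  define I where "I = {..<length G} - U - A"
  define a where "a = nths G A"
  define E where "E = (!) G ` I"
  define V where "V = set S - set a"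
  have A': "A \<subseteq> {..<length G}" and fins: "finite A" "finite U" "finite I"
    using A U by (auto simp: I_def intro: finite_subset[of _ "{..<length G}"])
  have injG: "inj_on ((!) G) {..<length G}" using GS by (simp add: inj_on_nth)
  have seta: "set a = (!) G ` A" unfolding a_def using A' by (rule set_nths_eq_image)
  have lena: "length a = card A" unfolding a_def using A' by (rule length_nths_eq_card)
  have dista: "distinct a" unfolding a_def using GS by (simp add: distinct_nthsI)
  have aS: "set a \<subseteq> set S" using seta A' GS(3) by force
  have setG: "set G = (!) G ` {..<length G}" by (auto simp: set_conv_nth)
  have injI: "inj_on ((!) G) I" using injG by (rule inj_on_subset) (auto simp: I_def)
  have cI: "card I + card U + card A = length G"
  proof -
    have "card I = card ({..<length G} - U) - card A"
      unfolding I_def using A fins by (intro card_Diff_subset) auto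
    moreover have "card ({..<length G} - U) = length G - card U"
      using U fins by (simp add: card_Diff_subset)
    ultimately show ?thesis using lt by linarith
  qed
  have cE: "card E = card I" unfolding E_def by (rule card_image[OF injI])
  have cV: "card V + card A = length S"
  proof -
    have "card V = length S - card A"
      unfolding V_def using aS GS dista lena by (simp add: card_Diff_subset distinct_card)
    moreover have "card (set a) \<le> card (set S)" using aS by (intro card_mono) auto
    ultimately show ?thesis using GS dista lena by (simp add: distinct_card)
  qed
  \<comment> \<open>Removing \<open>A\<close> from both families subtracts
    \<open>2 * (k - 2)\<close>, and removing \<open>U\<close> from \<open>G\<close> cancels
    \<open>card U\<close>; this leaves \<open>q + 3\<close>.\<close>
  have cVE: "card V + card E = CARD('a) + 3" using cI cE cV cards A(2) k by linarith
  have disj: "(!) G ` J \<inter> (!) G ` K = {}"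
    if "J \<subseteq> {..<length G}" "K \<subseteq> {..<length G}" "J \<inter> K = {}" for J K
    using that injG by (metis inj_on_image_Int image_empty)
  have EV: "E \<subseteq> V"
  proof -
    have "E \<inter> set a = {}" unfolding E_def seta using A' by (intro disj) (auto simp: I_def)
    moreover have "E \<subseteq> set S" using GS(3) by (auto simp: E_def I_def)
    ultimately show ?thesis by (auto simp: V_def)
  qed
  have term_eq: "arc_entry k B G (insert i A) (U, A) * kernel_weight k B G S (insert i A)
      = inverse ((\<Prod>s\<in>V - {G ! i}. det_wrt k B s (G ! i # a))
          * (\<Prod>u\<in>E - {G ! i}. det_wrt k B u (G ! i # a)))" (is "_ = inverse (?P * ?Q)")
    if i: "i \<in> I" for i
  proof -
    let ?c = "nths G (insert i A)"
    have iA: "insert i A \<subseteq> {..<length G}" "insert i A \<subseteq> {..<length G} - U" "i \<notin> A" "i < length G"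
      using i A by (auto simp: I_def)
    have setc: "set ?c = insert (G ! i) (set a)"
      unfolding set_nths_eq_image[OF iA(1)] seta by simp
    have eE: "G ! i \<in> E" using i by (simp add: E_def)
    then have eV: "G ! i \<in> V" using EV by blast
    have ms: "mset ?c = mset (G ! i # a)"
      using setc dista GS eV
      by (subst set_eq_iff_mset_eq_distinct[symmetric]) (auto simp: V_def distinct_nthsI)
    \<comment> \<open>\<open>s\<close> is the sign of sorting \<open>G ! i\<close> into its place
      among \<open>a\<close>. It is the same for every first row \<open>u\<close>.\<close>
    obtain s :: 'a where s: "s = 1 \<or> s = -1" and
      ds: "\<And>p. length p + length ?c = k \<Longrightarrow>
        det (mat_of_rows k (p @ ?c)) = s * det (mat_of_rows k (p @ G ! i # a))"
      using det_rows_mset_eq[OF ms, of k] by metis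
    have lenc: "length ?c = Suc (card A)"
      using length_nths_eq_card[OF iA(1)] iA(3) fins by simp
    have dc: "det_wrt k B u ?c = s * det_wrt k B u (G ! i # a)" if "u \<in> set S" for u
    proof -
      have "set ?c \<subseteq> carrier_vec k" "set (G ! i # a) \<subseteq> carrier_vec k"
        using setc aS eV GS(4) by (auto simp: V_def)
      then show ?thesis
        using det_wrt_eq_det_rows[OF B, of ?c u] det_wrt_eq_det_rows[OF B, of "G ! i # a" u]
          ds[of "[u]"] lenc lena A(2) that GS(4) by auto
    qed
    let ?UG = "(!) G ` U"
    have UGS: "?UG \<subseteq> set S - set ?c"
    proof -
      have "?UG \<inter> (!) G ` insert i A = {}" using U iA by (intro disj) auto
      moreover have "?UG \<subseteq> set S" using U GS(3) setG by blast
      ultimately show ?thesis unfolding set_nths_eq_image[OF iA(1)] by blast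
    qed
    have split: "set G - set ?c = ?UG \<union> (E - {G ! i})"
    proof -
      have "set G = ?UG \<union> E \<union> set a" unfolding setG E_def seta using U A' by (auto simp: I_def)
      then show ?thesis using setc UGS EV by (auto simp: V_def)
    qed
    have dsj: "?UG \<inter> (E - {G ! i}) = {}"
    proof -
      have "?UG \<inter> E = {}" unfolding E_def using U by (intro disj) (auto simp: I_def)
      then show ?thesis by blast
    qed
    \<comment> \<open>\<open>R\<close> is both the matrix entry and the part over \<open>U\<close>
      of the second product in the weight.\<close>
    define R where "R = (\<Prod>u\<in>?UG. det_wrt k B u ?c)"
    have Rnz: "R \<noteq> 0"
      unfolding R_def using UGS det_wrt_nths_nonzero[OF iA(1)] lenc A(2) iA(3) fins
      by (auto simp: prod_zero_iff)
    have entry: "arc_entry k B G (insert i A) (U, A) = R"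
      unfolding arc_entry_def R_def using iA(2)
      by (auto simp: prod.reindex[OF inj_on_subset[OF injG U]])
    have "(\<Prod>u\<in>set G - set ?c. det_wrt k B u ?c) = R * (\<Prod>u\<in>E - {G ! i}. det_wrt k B u ?c)"
      unfolding split R_def using dsj fins by (intro prod.union_disjoint) (auto simp: E_def)
    also have "(\<Prod>u\<in>E - {G ! i}. det_wrt k B u ?c)
        = (\<Prod>u\<in>E - {G ! i}. s * det_wrt k B u (G ! i # a))"
      using EV by (intro prod.cong refl dc) (auto simp: V_def)
    also have "\<dots> = s ^ (card E - 1) * ?Q"
      using eE fins by (simp add: prod.distrib E_def)
    finally have 1: "(\<Prod>u\<in>set G - set ?c. det_wrt k B u ?c) = R * (s ^ (card E - 1) * ?Q)" .
    have "set S - set ?c = V - {G ! i}" using setc by (auto simp: V_def)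
    then have "(\<Prod>u\<in>set S - set ?c. det_wrt k B u ?c)
        = (\<Prod>u\<in>V - {G ! i}. s * det_wrt k B u (G ! i # a))"
      by (intro prod.cong dc) (auto simp: V_def)
    also have "\<dots> = s ^ (card V - 1) * ?P"
      using eV by (simp add: prod.distrib V_def)
    finally have 2: "(\<Prod>u\<in>set S - set ?c. det_wrt k B u ?c) = s ^ (card V - 1) * ?P" .
    have "card V > 0" "card E > 0" using eV eE fins by (auto simp: card_gt_0_iff V_def E_def)
    \<comment> \<open>The sign \<open>s\<close> occurs \<open>q + 1\<close> times, and
      \<open>s ^ (q + 1) = s * s = 1\<close> in every characteristic.\<close>
    then have "(card V - 1) + (card E - 1) = CARD('a) + 1" using cVE by linarith
    then have "s ^ (card V - 1) * s ^ (card E - 1) = s ^ (CARD('a) + 1)"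
      by (simp only: power_add[symmetric])
    also have "\<dots> = 1" using s by (auto simp: finite_field_power_card)
    finally have sgn: "s ^ (card V - 1) * s ^ (card E - 1) = 1" .
    have "kernel_weight k B G S (insert i A)
        = inverse ((s ^ (card V - 1) * s ^ (card E - 1)) * (R * (?P * ?Q)))"
      unfolding kernel_weight_def 1 2 by (simp only: mult_ac)
    then show ?thesis unfolding entry sgn using Rnz by simp
  qed
  let ?T = "{C. C \<subseteq> {..<length G} \<and> card C + 1 = k}"
  let ?f = "\<lambda>C. arc_entry k B G C (U, A) * kernel_weight k B G S C"
  have finT: "finite ?T" by (rule finite_subset[of _ "Pow {..<length G}"]) auto
  have "(\<Sum>C\<in>?T. ?f C) = (\<Sum>C\<in>(\<lambda>i. insert i A) ` I. ?f C)"
  proof (rule sum.mono_neutral_right[OF finT])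
    show "(\<lambda>i. insert i A) ` I \<subseteq> ?T" using A' A(2) fins by (auto simp: I_def)
    show "\<forall>C\<in>?T - (\<lambda>i. insert i A) ` I. ?f C = 0"
    proof
      fix C assume C: "C \<in> ?T - (\<lambda>i. insert i A) ` I"
      \<comment> \<open>A row label has one element more than \<open>A\<close>, so containing
        \<open>A\<close> and avoiding \<open>U\<close> would put \<open>C\<close> into the image of
        \<open>I\<close>.\<close>
      have "\<not> (A \<subseteq> C \<and> C \<subseteq> {..<length G} - U)"
      proof
        assume AC: "A \<subseteq> C \<and> C \<subseteq> {..<length G} - U"
        have "card (C - A) = card C - card A" using AC fins by (simp add: card_Diff_subset)
        then have "card (C - A) = 1" using C A(2) by auto
        then obtain i where i: "C - A = {i}" by (auto simp: card_1_singleton_iff)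
        then have "C = insert i A" "i \<in> I" using AC by (auto simp: I_def)
        then show False using C by blast
      qed
      then show "?f C = 0" unfolding arc_entry_def by auto
    qed
  qed
  also have "\<dots> = (\<Sum>i\<in>I. ?f (insert i A))"
    by (rule sum.reindex[unfolded o_def]) (auto simp: inj_on_def I_def)
  also have "\<dots> = (\<Sum>e\<in>E. inverse ((\<Prod>s\<in>V - {e}. det_wrt k B s (e # a))
          * (\<Prod>u\<in>E - {e}. det_wrt k B u (e # a))))"
    unfolding E_def sum.reindex[OF injI] o_def
    by (intro sum.cong refl term_eq[unfolded E_def])
  also have "\<dots> = 0"
    unfolding V_def
  proof (rule arc_bracket_sum[OF arc B dista aS])
    show "E \<noteq> {}" using cE cI lt by auto
  qed (use lena A(2) EV cVE in \<open>auto simp: V_def\<close>)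
  finally show ?thesis .
qed

end

section \<open>Contradiction with full row rank\<close>

theorem theorem1p4:
  fixes G B :: "'a::{field,finite} vec list" and k n :: nat
  assumes "k \<ge> 1"
    and "is_arc k G"
    and "basis_family k B"
    and "n + k - 1 \<le> length G"
    and "real (length G) \<le> (real CARD('a) + 2 * real k - 2 + real n) / 2"
    and "full_row_rank (arc_matrix k B G n)"
  shows "\<not> (\<exists>S :: 'a vec list.
           is_arc k S \<and> length S = CARD('a) + 2 * k - 1 + n - length G \<and> subseq G S)"
proof
  assume "\<exists>S :: 'a vec list.
    is_arc k S \<and> length S = CARD('a) + 2 * k - 1 + n - length G \<and> subseq G S"
  then obtain S :: "'a vec list" where S: "is_arc k S"
    "length S = CARD('a) + 2 * k - 1 + n - length G" "subseq G S" by blast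
  define M where "M = arc_matrix k B G n"
  define rs where "rs = row_labels k (length G)"
  define cs where "cs = col_labels k n (length G)"
  have M: "M \<in> carrier_mat (length rs) (length cs)"
    by (simp add: M_def arc_matrix_def rs_def cs_def)
  have rank: "vec_space.rank (length rs) M = length rs"
    using assms(6) M by (simp add: full_row_rank_def M_def)
  have rs: "distinct rs" "set rs = {C. C \<subseteq> {..<length G} \<and> card C + 1 = k}"
    unfolding rs_def by (rule row_labels_enum)+
  have kG: "k \<le> length G" using assms(2) by (simp add: is_arc_def)
  \<comment> \<open>At least one row exists, so a vector with nonzero entries cannot be the zero
    vector.\<close>
  have "{..<k - 1} \<in> set rs" using rs(2) kG assms(1) by auto
  then have rs_ne: "0 < length rs" by (auto dest: length_pos_if_in_set)
  show False
  proof (cases "k = 1")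
    case True
    \<comment> \<open>No \<open>A\<close> satisfies \<open>card A + 2 = 1\<close>, so the matrix has
      no columns and its rank is 0.\<close>
    then have "set cs = {}" unfolding cs_def col_labels_enum(2) by auto
    then have "vec_space.rank (length rs) M \<le> 0"
      using vec_space.rank_le_nc[OF M] by simp
    then show False using rank rs_ne by simp
  next
    case False
    then have k: "2 \<le> k" using assms(1) by simp
    \<comment> \<open>The upper bound on \<open>length G\<close> makes the truncated subtraction in
      \<open>length S\<close> exact.\<close>
    have "2 * real (length G) \<le> real CARD('a) + 2 * real k - 2 + real n"
      using assms(5) by simp
    then have "2 * length G + 2 \<le> CARD('a) + 2 * k + n" by linarith
    then have lenS: "length S + length G = CARD('a) + 2 * k - 1 + n" using S(2) by linarith
    define v where "v = vec (length rs) (\<lambda>i. kernel_weight k B G S (rs ! i))"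
    have "v = 0\<^sub>v (length rs)"
    proof (rule vec_space.full_rank_left_kernel[OF M rank])
      fix j assume j: "j < length cs"
      obtain U A where UA: "cs ! j = (U, A)" by force
      then have "(U, A) \<in> set cs" using j nth_mem by metis
      then have U: "U \<subseteq> {..<length G}" "card U = n" and A: "A \<subseteq> {..<length G} - U" "card A + 2 = k"
        unfolding cs_def col_labels_enum(2) by auto
      have "col M j \<bullet> v
          = (\<Sum>i<length rs. arc_entry k B G (rs ! i) (U, A) * kernel_weight k B G S (rs ! i))"
        using j M UA
        by (simp add: scalar_prod_def v_def M_def arc_matrix_def rs_def cs_def lessThan_atLeast0)
      also have "\<dots> = (\<Sum>C\<in>set rs. arc_entry k B G C (U, A) * kernel_weight k B G S C)"
        by (rule sum.reindex_bij_betw[OF bij_betw_nth[OF rs(1) refl refl]])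
      also have "\<dots> = 0"
        unfolding rs(2)
      proof (rule column_orthogonal_kernel_weight[OF k S(1) assms(3) S(3) U(1) A])
        \<comment> \<open>\<open>n + (k - 2)\<close> is one less than \<open>n + k - 1\<close>, so
          some position lies outside \<open>U\<close> and \<open>A\<close>.\<close>
        show "card U + card A < length G" using U(2) A(2) assms(4) by linarith
        show "length S + length G = CARD('a) + 2 * k - 1 + card U" using lenS U(2) by simp
      qed
      finally show "col M j \<bullet> v = 0" .
    qed (simp add: v_def)
    then have "v $ 0 = 0" using rs_ne by simp
    then have "kernel_weight k B G S (rs ! 0) = 0" using rs_ne by (simp add: v_def)
    moreover have "rs ! 0 \<in> set rs" using rs_ne nth_mem by blast
    ultimately show False
      using kernel_weight_nonzero[OF k S(1) assms(3) S(3), of "rs ! 0"] rs(2) by simp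
  qed
qed

end
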